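(* Let $m,q\geq 2$ be integers and let $s,t\ge 0$ be integers. Consider the conjugate $(m,q)$-ary partitions $\lambda$ generated (from $(1)_m$) by a sequence with a total of $t$ operations of $R$ and $s$ operations of $M$, in some order. Then (1) the minimum $n$ that such a $\lambda$ can partition is $m^s+q^t-1$, with $\lambda = M^sR^t(1)_m$, which is $(1,0,\ldots,0,q^t-1)_m$ (with $s-1$ zeros in the middle) if $s>0$, or $(q^t)_m$ if $s=0$; (2) the maximum $n$ that such a $\lambda$ can partition is $m^sq^t$, with $\lambda = R^tM^s(1)_m = (q^t, 0,\ldots, 0)_m$ (with $s$ zeros).
   Context: Let $m,q\ge 2$ be integers. A partition $\lambda$ of a positive integer $n$ is $m$-ary if all its parts are powers $m^i$, $i\ge 0$ (so $m^0=1$ is allowed). If $a_i$ is the number of times the part $m^i$ appears in $\lambda$, one writes $\lambda=(a_k,a_{k-1},\ldots,a_0)_m$, where $a_k\neq 0$ and $a_i=0$ for $i>k$. $\lambda$ is conjugate $(m,q)$-ary if $\lambda$ is $m$-ary and its conjugate $\lambda'$ is $q$-ary; equivalently, $\lambda$ is $m$-ary and each partial sum $\sum_{i=r}^k a_i$, $0\le r\le k$, is a power of $q$ (with $q^0=1$ allowed). For a conjugate $(m,q)$-ary partition $\lambda=(a_k,\ldots,a_0)_m$, define the operators (each producing a conjugate $(m,q)$-ary partition): raise $R(\lambda)=(qa_k,\ldots,qa_0)_m$ and migration $M(\lambda)=(1,a_k-1,a_{k-1},\ldots,a_0)_m$. Sequences of operators are composed as functions (rightmost applied first); a sequence $A$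 generates the partition $A(1)_m$, where $(1)_m$ is the trivial partition of $1$. *)

theory Defs
  imports "HOL-Library.Multiset"
begin

section \<open>Partitions\<close>

text \<open>A partition is the multiset of its parts.\<close>

definition partitions :: "nat multiset \<Rightarrow> nat \<Rightarrow> bool" where
  "partitions \<nu> n \<longleftrightarrow> 0 < n \<and> 0 \<notin># \<nu> \<and> sum_mset \<nu> = n"

text \<open>The \<open>j\<close>-th part of the conjugate is the number of parts of size at least \<open>j\<close>
  (the length of the \<open>j\<close>-th column of the Young diagram), for \<open>j\<close> from 1 up to the largest part.\<close>

definition conj_part :: "nat multiset \<Rightarrow> nat multiset" where
  "conj_part \<nu> = {#size {#p \<in># \<nu>. j \<le> p#}. j \<in># mset_set {j. 1 \<le> j \<and> (\<exists>p \<in># \<nu>. j \<le> p)}#}"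

definition m_ary :: "nat \<Rightarrow> nat multiset \<Rightarrow> bool" where
  "m_ary m \<nu> \<longleftrightarrow> (\<exists>n. partitions \<nu> n) \<and> (\<forall>p \<in># \<nu>. \<exists>i. p = m ^ i)"

definition conj_ary :: "nat \<Rightarrow> nat \<Rightarrow> nat multiset \<Rightarrow> bool" where
  "conj_ary m q \<nu> \<longleftrightarrow> m_ary m \<nu> \<and> m_ary q (conj_part \<nu>)"

section \<open>The notation \<open>(a\<^sub>k, \<dots>, a\<^sub>0)\<^sub>m\<close>\<close>

text \<open>\<open>mary m [a\<^sub>k, \<dots>, a\<^sub>0]\<close> has \<open>a\<^sub>i\<close> parts equal to \<open>m ^ i\<close>; the most significant
  multiplicity comes first.\<close>

fun mary :: "nat \<Rightarrow> nat list \<Rightarrow> nat multiset" where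
  "mary m [] = {#}"
| "mary m (a # as) = replicate_mset a (m ^ length as) + mary m as"

text \<open>Conversely, the list \<open>[a\<^sub>k, \<dots>, a\<^sub>0]\<close> of an \<open>m\<close>-ary partition. Lemmas
  \<open>mults_mary\<close> and \<open>mary_mults\<close> below show that the two are mutually inverse for lists
  with nonzero head.\<close>

definition mults :: "nat \<Rightarrow> nat multiset \<Rightarrow> nat list" where
  "mults m \<nu> = map (\<lambda>i. count \<nu> (m ^ i)) (rev [0..<Suc (Max {i. m ^ i \<in># \<nu>})])"

section \<open>The operators\<close>

definition raise :: "nat \<Rightarrow> nat \<Rightarrow> nat multiset \<Rightarrow> nat multiset" where
  "raise m q \<nu> = mary m (map (\<lambda>a. q * a) (mults m \<nu>))"

text \<open>\<open>mults m \<nu>\<close> is never empty.\<close>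

definition migrate :: "nat \<Rightarrow> nat multiset \<Rightarrow> nat multiset" where
  "migrate m \<nu> = (case mults m \<nu> of a # as \<Rightarrow> mary m (1 # (a - 1) # as))"

datatype operator = R | M

fun apply_op :: "nat \<Rightarrow> nat \<Rightarrow> operator \<Rightarrow> nat multiset \<Rightarrow> nat multiset" where
  "apply_op m q R = raise m q"
| "apply_op m q M = migrate m"

text \<open>A sequence of operators acts by composition, the rightmost operator first.\<close>

definition apply_ops :: "nat \<Rightarrow> nat \<Rightarrow> operator list \<Rightarrow> nat multiset \<Rightarrow> nat multiset" where
  "apply_ops m q A = foldr (apply_op m q) A"

text \<open>The condition \<open>conj_ary m q \<nu>\<close> is redundant for \<open>m, q \<ge> 2\<close>; see
  \<open>conj_ary_apply_ops\<close>.\<close>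

definition generated :: "nat \<Rightarrow> nat \<Rightarrow> nat \<Rightarrow> nat \<Rightarrow> nat multiset set" where
  "generated m q s t =
     {\<nu>. conj_ary m q \<nu> \<and>
         (\<exists>A. count_list A R = t \<and> count_list A M = s \<and> \<nu> = apply_ops m q A (mary m [1]))}"

section \<open>Adequacy of the definitions\<close>

lemma count_mary:
  assumes "m \<ge> 2"
  shows "count (mary m as) (m ^ i) = (if i < length as then rev as ! i else 0)"
  using assms by (induction as) (auto simp: nth_append)

lemma mary_parts: "p \<in># mary m as \<Longrightarrow> \<exists>i. p = m ^ i"
  by (induction as) (auto split: if_splits)

lemma mary_max:
  assumes "m \<ge> 2" "a \<noteq> 0"
  shows "Max {i. m ^ i \<in># mary m (a # as)} = length as"
proof (rule Max_eqI)
  have *: "i \<le> length as" if "m ^ i \<in># mary m (a # as)" for i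
  proof -
    have "count (mary m (a # as)) (m ^ i) \<noteq> 0" using that by (metis not_in_iff)
    then have "i < length (a # as)" using count_mary[OF assms(1), of "a # as" i] by presburger
    then show ?thesis by simp
  qed
  then show "finite {i. m ^ i \<in># mary m (a # as)}"
    unfolding finite_nat_set_iff_bounded_le by blast
  show "\<And>y. y \<in> {i. m ^ i \<in># mary m (a # as)} \<Longrightarrow> y \<le> length as" using * by blast
  show "length as \<in> {i. m ^ i \<in># mary m (a # as)}" using assms by simp
qed

lemma mults_mary:
  assumes "m \<ge> 2" "a \<noteq> 0"
  shows "mults m (mary m (a # as)) = a # as"
proof -
  have "mults m (mary m (a # as)) =
        map (\<lambda>i. count (mary m (a # as)) (m ^ i)) (rev [0..<length (a # as)])"
    unfolding mults_def mary_max[OF assms] by simp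
  also have "\<dots> = map (\<lambda>i. rev (a # as) ! i) (rev [0..<length (rev (a # as))])"
    using count_mary[OF assms(1), of "a # as"] by (intro map_cong) auto
  also have "\<dots> = a # as"
    unfolding rev_map[symmetric] map_nth by simp
  finally show ?thesis .
qed

lemma mary_mults:
  assumes "m \<ge> 2" "m_ary m \<nu>"
  shows "mary m (mults m \<nu>) = \<nu>" "mults m \<nu> \<noteq> []" "hd (mults m \<nu>) \<noteq> 0"
proof -
  let ?S = "{i. m ^ i \<in># \<nu>}"
  let ?k = "Max ?S"
  have "inj_on (\<lambda>i. m ^ i) ?S" using assms(1) by (auto intro: inj_onI)
  moreover have "(\<lambda>i. m ^ i) ` ?S \<subseteq> set_mset \<nu>" by auto
  ultimately have fin: "finite ?S" by (meson finite_set_mset inj_on_finite)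
  have "\<nu> \<noteq> {#}" using assms(2) by (auto simp: m_ary_def partitions_def)
  then obtain p where "p \<in># \<nu>" by blast
  then have ne: "?S \<noteq> {}" using assms(2) by (auto simp: m_ary_def)
  have k: "m ^ ?k \<in># \<nu>" using Max_in[OF fin ne] by simp
  show "mults m \<nu> \<noteq> []" by (simp add: mults_def)
  show "hd (mults m \<nu>) \<noteq> 0" using k by (simp add: mults_def)
  show "mary m (mults m \<nu>) = \<nu>"
  proof (rule multiset_eqI)
    fix p
    show "count (mary m (mults m \<nu>)) p = count \<nu> p"
    proof (cases "\<exists>i. p = m ^ i")
      case True
      then obtain i where p: "p = m ^ i" by blast
      have "count (mary m (mults m \<nu>)) p = (if i < Suc ?k then count \<nu> (m ^ i) else 0)"
        unfolding p count_mary[OF assms(1)] by (simp add: mults_def rev_map del: upt_Suc)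
      moreover have "count \<nu> (m ^ i) = 0" if "\<not> i < Suc ?k"
        using that Max_ge[OF fin, of i] by (metis mem_Collect_eq not_in_iff less_Suc_eq_le)
      ultimately show ?thesis unfolding p by auto
    next
      case False
      then show ?thesis using assms(2) mary_parts[of p m]
        by (metis m_ary_def not_in_iff)
    qed
  qed
qed

lemma raise_mary:
  "m \<ge> 2 \<Longrightarrow> a \<noteq> 0 \<Longrightarrow> raise m q (mary m (a # as)) = mary m (map (\<lambda>a. q * a) (a # as))"
  by (simp add: raise_def mults_mary del: mary.simps)

lemma migrate_mary:
  "m \<ge> 2 \<Longrightarrow> a \<noteq> 0 \<Longrightarrow> migrate m (mary m (a # as)) = mary m (1 # (a - 1) # as)"
  by (simp add: migrate_def mults_mary del: mary.simps)

lemma m_ary_iff: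
  assumes "m \<ge> 2"
  shows "m_ary m \<nu> \<longleftrightarrow> \<nu> \<noteq> {#} \<and> (\<forall>p \<in># \<nu>. \<exists>i. p = m ^ i)"
proof -
  have "0 \<notin># \<nu>" if "\<forall>p \<in># \<nu>. \<exists>i. p = m ^ i" using that assms by fastforce
  moreover have "0 < sum_mset \<nu>" if "\<nu> \<noteq> {#}" "0 \<notin># \<nu>"
    using that by (metis gr0I multiset_nonemptyE sum_mset_0_iff)
  ultimately show ?thesis by (auto simp: m_ary_def partitions_def)
qed

lemma finite_columns: "finite {j. 1 \<le> j \<and> (\<exists>p \<in># \<nu>. j \<le> (p::nat))}"
proof -
  have "{j. 1 \<le> j \<and> (\<exists>p \<in># \<nu>. j \<le> p)} \<subseteq> (\<Union>p \<in> set_mset \<nu>. {..p})" by auto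
  then show ?thesis by (rule finite_subset) auto
qed

lemma conj_ary_iff:
  assumes "m \<ge> 2" "q \<ge> 2"
  shows "conj_ary m q \<nu> \<longleftrightarrow> \<nu> \<noteq> {#} \<and> (\<forall>p \<in># \<nu>. \<exists>i. p = m ^ i) \<and>
    (\<forall>j p. 1 \<le> j \<longrightarrow> p \<in># \<nu> \<longrightarrow> j \<le> p \<longrightarrow> (\<exists>i. size {#p \<in># \<nu>. j \<le> p#} = q ^ i))"
proof -
  let ?C = "{j. 1 \<le> j \<and> (\<exists>p \<in># \<nu>. j \<le> p)}"
  have set: "set_mset (conj_part \<nu>) = (\<lambda>j. size {#p \<in># \<nu>. j \<le> p#}) ` ?C"
    using finite_columns[of \<nu>] by (simp add: conj_part_def)
  have ne: "conj_part \<nu> \<noteq> {#}" if n: "\<nu> \<noteq> {#}" "\<forall>p \<in># \<nu>. \<exists>i. p = m ^ i"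
  proof -
    obtain p where p: "p \<in># \<nu>" using \<open>\<nu> \<noteq> {#}\<close> by blast
    then obtain i where "p = m ^ i" using n(2) by blast
    then have "1 \<le> p" using assms(1) by simp
    then have "1 \<in> ?C" using p by blast
    then have "size {#p \<in># \<nu>. 1 \<le> p#} \<in># conj_part \<nu>" unfolding set by (rule imageI)
    then show ?thesis by (cases "conj_part \<nu>") simp_all
  qed
  show ?thesis unfolding conj_ary_def m_ary_iff[OF assms(1)] m_ary_iff[OF assms(2)] set
    using ne by (simp only: ball_simps mem_Collect_eq) blast
qed

lemma conj_ary_one: "m \<ge> 2 \<Longrightarrow> q \<ge> 2 \<Longrightarrow> conj_ary m q (mary m [1])"
  unfolding conj_ary_iff by (auto intro: exI[of _ 0])

lemma mary_raise: "mary m (map (\<lambda>a. q * a) as) = repeat_mset q (mary m as)"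
  by (induction as) (auto simp: multiset_eq_iff algebra_simps)

lemma conj_ary_raise:
  assumes "m \<ge> 2" "q \<ge> 2" "conj_ary m q \<nu>"
  shows "conj_ary m q (raise m q \<nu>)"
proof -
  have "m_ary m \<nu>" using assms(3) by (simp add: conj_ary_def)
  then have eq: "raise m q \<nu> = repeat_mset q \<nu>"
    using mary_mults(1)[OF assms(1)] by (simp add: raise_def mary_raise)
  have set: "x \<in># repeat_mset q \<nu> \<longleftrightarrow> x \<in># \<nu>" for x
    using assms(2) by (simp add: count_greater_zero_iff[symmetric] del: count_greater_zero_iff)
  have filt: "filter_mset P (repeat_mset q \<nu>) = repeat_mset q (filter_mset P \<nu>)" for P
    by (simp add: multiset_eq_iff)
  have size: "size (repeat_mset q \<mu>) = q * size \<mu>" for \<mu> :: "nat multiset"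
    by (induction q) auto
  show ?thesis using assms(3) unfolding eq conj_ary_iff[OF assms(1,2)] set filt size
  proof (elim conjE, intro conjI allI impI, goal_cases)
    case 1
    then show ?case using assms(2) by (simp add: repeat_mset_eq_empty_iff)
  next
    case 2
    then show ?case using set by blast
  next
    case (3 j p)
    then obtain i where "size {#p \<in># \<nu>. j \<le> p#} = q ^ i" by blast
    then show ?case by (intro exI[of _ "Suc i"]) simp
  qed
qed

lemma conj_ary_migrate:
  assumes "m \<ge> 2" "q \<ge> 2" "conj_ary m q \<nu>"
  shows "conj_ary m q (migrate m \<nu>)"
proof -
  have "m_ary m \<nu>" using assms(3) by (simp add: conj_ary_def)
  from mary_mults[OF assms(1) this] obtain a as where
    \<nu>: "\<nu> = mary m (a # as)" and a: "a \<noteq> 0"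
    by (metis list.collapse)
  let ?k = "length as"
  define \<mu> where "\<mu> = replicate_mset (a - 1) (m ^ ?k) + mary m as"
  have \<nu>': "\<nu> = add_mset (m ^ ?k) \<mu>" using a by (cases a) (auto simp: \<nu> \<mu>_def)
  have mig: "migrate m \<nu> = add_mset (m ^ Suc ?k) \<mu>"
    unfolding \<nu> migrate_mary[OF assms(1) a] by (simp add: \<mu>_def)
  have le: "p \<le> m ^ ?k" if "p \<in># \<mu>" for p
  proof -
    have "p \<in># mary m (a # as)" using that \<nu>' \<nu> by simp
    moreover from mary_parts[OF this] obtain i where p: "p = m ^ i" by blast
    ultimately have "count (mary m (a # as)) (m ^ i) \<noteq> 0" by (metis not_in_iff)
    then have "i < length (a # as)" using count_mary[OF assms(1), of "a # as" i] by presburger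
    then show ?thesis using p assms(1) by (auto intro: power_increasing)
  qed
  have lt: "m ^ ?k \<le> m ^ Suc ?k" using assms(1) by simp
  note C = assms(3)[unfolded conj_ary_iff[OF assms(1,2)]]
  show ?thesis unfolding conj_ary_iff[OF assms(1,2)] mig
  proof (intro conjI allI impI)
    show "add_mset (m ^ Suc ?k) \<mu> \<noteq> {#}" by simp
    show "\<forall>p \<in># add_mset (m ^ Suc ?k) \<mu>. \<exists>i. p = m ^ i"
      using C by (auto simp: \<nu>' simp del: power_Suc)
    fix j p assume j: "1 \<le> j" "p \<in># add_mset (m ^ Suc ?k) \<mu>" "j \<le> p"
    have jle: "j \<le> m ^ Suc ?k" 
    proof (cases "p = m ^ Suc ?k")
      case False
      then have "p \<le> m ^ ?k" using j(2) le by simp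
      then show ?thesis using j(3) lt by linarith
    qed (use j(3) in simp)
    show "\<exists>i. size {#p \<in># add_mset (m ^ Suc ?k) \<mu>. j \<le> p#} = q ^ i"
    proof (cases "j \<le> m ^ ?k")
      case True
      then have "size {#p \<in># add_mset (m ^ Suc ?k) \<mu>. j \<le> p#} = size {#p \<in># \<nu>. j \<le> p#}"
        using jle by (simp add: \<nu>' del: power_Suc)
      moreover have "m ^ ?k \<in># \<nu>" by (simp add: \<nu>')
      ultimately show ?thesis using C True j(1) by metis
    next
      case False
      have "{#p \<in># \<mu>. j \<le> p#} = {#p \<in># \<mu>. False#}"
        by (rule filter_mset_cong) (use le False in force)+
      then show ?thesis using jle by (auto intro: exI[of _ 0] simp del: power_Suc)
    qed
  qed
qed

lemma conj_ary_apply_ops: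
  assumes "m \<ge> 2" "q \<ge> 2"
  shows "conj_ary m q (apply_ops m q A (mary m [1]))"
proof (induction A)
  case Nil
  then show ?case using conj_ary_one[OF assms] by (simp add: apply_ops_def)
next
  case (Cons x A)
  then show ?case using conj_ary_raise[OF assms] conj_ary_migrate[OF assms]
    by (cases x) (simp_all add: apply_ops_def)
qed

lemma finite_generated: "finite (generated m q s t)"
proof -
  have len: "length A = count_list A R + count_list A M" for A :: "operator list"
  proof (induction A)
    case (Cons x A)
    then show ?case by (cases x) auto
  qed simp
  have "UNIV = {R, M}" by (auto intro: operator.exhaust)
  then have "finite (UNIV :: operator set)" by (metis finite.emptyI finite_insert)
  then have "finite {A :: operator list. set A \<subseteq> UNIV \<and> length A = s + t}"
    by (rule finite_lists_length_eq)
  then have "finite ((\<lambda>A. apply_ops m q A (mary m [1])) ` {A. length A = s + t})" by simp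
  moreover have "generated m q s t \<subseteq> (\<lambda>A. apply_ops m q A (mary m [1])) ` {A. length A = s + t}"
    using len by (fastforce simp: generated_def)
  ultimately show ?thesis by (rule finite_subset[rotated])
qed

text \<open>Hence \<open>Min\<close> and \<open>Max\<close> over the set of partitioned numbers are attained extrema.\<close>

lemma finite_partitioned: "finite {n. \<exists>\<nu> \<in> generated m q s t. partitions \<nu> n}"
  by (rule finite_subset[OF _ finite_imageI[OF finite_generated, where h = sum_mset]])
     (auto simp: partitions_def)

lemma partitioned_nonempty:
  assumes "m \<ge> 2" "q \<ge> 2"
  shows "{n. \<exists>\<nu> \<in> generated m q s t. partitions \<nu> n} \<noteq> {}"
proof -
  let ?A = "replicate s M @ replicate t R"
  let ?l = "apply_ops m q ?A (mary m [1])"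
  have c: "count_list (replicate n x) y = (if x = y then n else 0)" for n and x y :: operator
    by (induction n) auto
  have "conj_ary m q ?l" by (rule conj_ary_apply_ops[OF assms])
  moreover from this have "\<exists>n. partitions ?l n" by (simp add: conj_ary_def m_ary_def)
  moreover have "count_list ?A R = t" "count_list ?A M = s" by (simp_all add: c)
  ultimately show ?thesis unfolding generated_def by blast
qed

end

theory Submission
  imports Defs
begin

text \<open>Two statistics of \<open>A(1)\<^sub>m\<close> do not depend on the order of the operators in \<open>A\<close>: raising
  multiplies the number of parts by \<open>q\<close> and leaves the largest part alone, while migration
  multiplies the largest part by \<open>m\<close> and leaves the number of parts alone. So every partition
  generated by \<open>t\<close> raises and \<open>s\<close> migrations has exactly \<open>q ^ t\<close> parts and largest part \<open>m ^ s\<close>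
  (\<open>generated_invariant\<close>).

  These two statistics alone force both bounds. The sum is at most \<open>m ^ s * q ^ t\<close>, with equality
  only if all parts equal \<open>m ^ s\<close>; and since one part is \<open>m ^ s\<close> and the remaining \<open>q ^ t - 1\<close> are
  positive, the sum is at least \<open>m ^ s + q ^ t - 1\<close>, with equality only if all remaining parts
  are 1. It remains to compute that \<open>R\<^sup>tM\<^sup>s(1)\<^sub>m\<close> and \<open>M\<^sup>sR\<^sup>t(1)\<^sub>m\<close> are these two extremal
  multisets.\<close>

section \<open>Multisets with bounded elements\<close>

lemma sum_mset_le_size_mult:
  fixes \<nu> :: "nat multiset"
  assumes "\<forall>p \<in># \<nu>. p \<le> b"
  shows "sum_mset \<nu> \<le> size \<nu> * b"
  using assms by (induction \<nu>) auto

lemma sum_mset_eq_upper_imp_replicate: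
  fixes \<nu> :: "nat multiset"
  assumes "\<forall>p \<in># \<nu>. p \<le> b" and "sum_mset \<nu> = size \<nu> * b"
  shows "\<nu> = replicate_mset (size \<nu>) b"
  using assms
proof (induction \<nu>)
  case (add p \<nu>)
  have "sum_mset \<nu> \<le> size \<nu> * b" using add.prems(1) by (intro sum_mset_le_size_mult) auto
  then have "p = b" "sum_mset \<nu> = size \<nu> * b" using add.prems by auto
  then show ?case using add by auto
qed simp

lemma size_le_sum_mset:
  fixes \<nu> :: "nat multiset"
  assumes "0 \<notin># \<nu>"
  shows "size \<nu> \<le> sum_mset \<nu>"
  using assms by (induction \<nu>) auto

lemma sum_mset_eq_size_imp_replicate:
  fixes \<nu> :: "nat multiset"
  assumes "0 \<notin># \<nu>" and "sum_mset \<nu> = size \<nu>"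
  shows "\<nu> = replicate_mset (size \<nu>) 1"
  using assms
proof (induction \<nu>)
  case (add p \<nu>)
  have "size \<nu> \<le> sum_mset \<nu>" using add.prems(1) by (intro size_le_sum_mset) auto
  then have "p = 1" "sum_mset \<nu> = size \<nu>" using add.prems by auto
  then show ?case using add by auto
qed simp

section \<open>The number of parts and the largest part\<close>

lemma size_mary: "size (mary m as) = sum_list as"
  by (induction as) auto

lemma mary_append_zeros: "mary m (replicate k 0 @ as) = mary m as"
  by (induction k) auto

lemma mary_zeros: "mary m (replicate k 0) = {#}"
  by (induction k) auto

lemma mary_part_le:
  assumes "m \<ge> 2" and "p \<in># mary m (a # as)"
  shows "p \<le> m ^ length as"
  using assms(2)
proof (induction as arbitrary: a)
  case (Cons b as)
  have "m ^ length as \<le> m ^ Suc (length as)" using assms(1) by simp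
  then show ?case using Cons by (auto split: if_splits intro: order_trans)
qed (auto split: if_splits)

text \<open>The notation \<open>(a\<^sub>k, \<dots>, a\<^sub>0)\<^sub>m\<close> records both statistics: the number of parts is the sum of the
  entries, and the largest part is \<open>m ^ k\<close>. Tracking the list makes the effect of both operators
  immediate.\<close>

lemma apply_ops_form:
  assumes "m \<ge> 2" and "q \<ge> 2"
  shows "\<exists>a as. apply_ops m q A (mary m [1]) = mary m (a # as) \<and> a \<noteq> 0 \<and>
    length as = count_list A M \<and> sum_list (a # as) = q ^ count_list A R"
proof (induction A)
  case Nil
  show ?case by (intro exI[of _ 1] exI[of _ "[]"]) (simp add: apply_ops_def)
next
  case (Cons x A)
  then obtain a as where IH: "apply_ops m q A (mary m [1]) = mary m (a # as)" "a \<noteq> 0"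
    "length as = count_list A M" "sum_list (a # as) = q ^ count_list A R" by blast
  show ?case
  proof (cases x)
    case R
    have "apply_ops m q (x # A) (mary m [1]) = mary m ((q * a) # map ((*) q) as)"
      using IH(1) raise_mary[OF assms(1) IH(2), of q as] R by (simp add: apply_ops_def)
    moreover have "sum_list (q * a # map ((*) q) as) = q * sum_list (a # as)"
      using sum_list_const_mult[of q "\<lambda>x. x" "a # as"] by simp
    ultimately show ?thesis using IH R assms(2)
      by (intro exI[of _ "q * a"] exI[of _ "map ((*) q) as"]) simp
  next
    case M
    have "apply_ops m q (x # A) (mary m [1]) = mary m (1 # (a - 1) # as)"
      using IH(1) migrate_mary[OF assms(1) IH(2), of as] M by (simp add: apply_ops_def)
    then show ?thesis using IH M
      by (intro exI[of _ 1] exI[of _ "(a - 1) # as"]) simp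
  qed
qed

lemma generated_invariant:
  assumes "m \<ge> 2" and "q \<ge> 2" and "\<nu> \<in> generated m q s t"
  shows "size \<nu> = q ^ t" "m ^ s \<in># \<nu>" "\<forall>p \<in># \<nu>. p \<le> m ^ s" "0 \<notin># \<nu>"
proof -
  from assms(3) obtain A where "count_list A R = t" "count_list A M = s"
    "\<nu> = apply_ops m q A (mary m [1])" by (auto simp: generated_def)
  then obtain a as where \<nu>: "\<nu> = mary m (a # as)" and a: "a \<noteq> 0"
    and len: "length as = s" and sum: "sum_list (a # as) = q ^ t"
    using apply_ops_form[OF assms(1,2), of A] by blast
  show "size \<nu> = q ^ t" unfolding \<nu> size_mary sum ..
  show "m ^ s \<in># \<nu>" using a by (simp add: \<nu> len)
  show "\<forall>p \<in># \<nu>. p \<le> m ^ s" using mary_part_le[OF assms(1)] \<nu> len by blast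
  show "0 \<notin># \<nu>" using assms(3) by (auto simp: generated_def conj_ary_def m_ary_def partitions_def)
qed

lemma partitions_generated_iff:
  assumes "\<nu> \<in> generated m q s t"
  shows "partitions \<nu> n \<longleftrightarrow> sum_mset \<nu> = n"
  using assms by (auto simp: generated_def conj_ary_def m_ary_def partitions_def)

section \<open>Bounds on the sum\<close>

lemma sum_generated_le:
  assumes "m \<ge> 2" and "q \<ge> 2" and "\<nu> \<in> generated m q s t"
  shows "sum_mset \<nu> \<le> m ^ s * q ^ t"
  using sum_mset_le_size_mult generated_invariant[OF assms] by (metis mult.commute)

lemma sum_generated_eq_upper:
  assumes "m \<ge> 2" and "q \<ge> 2" and "\<nu> \<in> generated m q s t" and "sum_mset \<nu> = m ^ s * q ^ t"
  shows "\<nu> = replicate_mset (q ^ t) (m ^ s)"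
  using sum_mset_eq_upper_imp_replicate generated_invariant[OF assms(1-3)] assms(4)
  by (metis mult.commute)

lemma generated_split_largest:
  assumes "m \<ge> 2" and "q \<ge> 2" and "\<nu> \<in> generated m q s t"
  obtains \<mu> where "\<nu> = add_mset (m ^ s) \<mu>" "size \<mu> = q ^ t - 1" "0 \<notin># \<mu>"
proof -
  note inv = generated_invariant[OF assms]
  from inv(2) obtain \<mu> where \<mu>: "\<nu> = add_mset (m ^ s) \<mu>" by (metis multi_member_split)
  have "size \<mu> = q ^ t - 1" "0 \<notin># \<mu>" using inv(1,4) by (auto simp: \<mu>)
  with \<mu> show ?thesis by (rule that)
qed

lemma sum_generated_ge:
  assumes "m \<ge> 2" and "q \<ge> 2" and "\<nu> \<in> generated m q s t"
  shows "m ^ s + q ^ t - 1 \<le> sum_mset \<nu>"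
proof -
  obtain \<mu> where \<mu>: "\<nu> = add_mset (m ^ s) \<mu>" "size \<mu> = q ^ t - 1" "0 \<notin># \<mu>"
    using generated_split_largest[OF assms] .
  then show ?thesis using size_le_sum_mset[OF \<mu>(3)] by simp
qed

lemma sum_generated_eq_lower:
  assumes "m \<ge> 2" and "q \<ge> 2" and "\<nu> \<in> generated m q s t"
    and "sum_mset \<nu> = m ^ s + q ^ t - 1"
  shows "\<nu> = add_mset (m ^ s) (replicate_mset (q ^ t - 1) 1)"
proof -
  obtain \<mu> where \<mu>: "\<nu> = add_mset (m ^ s) \<mu>" "size \<mu> = q ^ t - 1" "0 \<notin># \<mu>"
    using generated_split_largest[OF assms(1-3)] .
  have "1 \<le> q ^ t" using assms(2) by simp
  then have "sum_mset \<mu> = size \<mu>" using assms(4) \<mu>(1,2) by simp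
  then show ?thesis using sum_mset_eq_size_imp_replicate[OF \<mu>(3)] \<mu>(1,2) by simp
qed

section \<open>The extremal partitions\<close>

lemma raise_funpow_mary:
  assumes "m \<ge> 2" and "q \<ge> 2" and "a \<noteq> 0"
  shows "(raise m q ^^ t) (mary m (a # as)) = mary m (map ((*) (q ^ t)) (a # as))"
proof (induction t)
  case 0
  show ?case by (simp del: mary.simps)
next
  case (Suc t)
  have "q ^ t * a \<noteq> 0" using assms by simp
  then show ?case using Suc raise_mary[OF assms(1), of "q ^ t * a" q "map ((*) (q ^ t)) as"]
    by (simp add: o_def mult.assoc del: mary.simps)
qed

text \<open>The first migration moves one of the \<open>a\<close> largest parts up; from then on the single
  largest part is alone and each further migration only inserts a zero behind it.\<close>

lemma migrate_funpow_mary: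
  assumes "m \<ge> 2" and "a \<noteq> 0"
  shows "(migrate m ^^ Suc k) (mary m (a # as)) =
    mary m (1 # replicate k 0 @ (a - 1) # as)"
proof (induction k)
  case 0
  show ?case by (simp add: migrate_mary[OF assms] del: mary.simps)
next
  case (Suc k)
  then have "(migrate m ^^ Suc (Suc k)) (mary m (a # as)) =
    migrate m (mary m (1 # replicate k 0 @ (a - 1) # as))" by (simp del: mary.simps)
  also have "\<dots> = mary m (1 # 0 # replicate k 0 @ (a - 1) # as)"
    using migrate_mary[OF assms(1), of 1] by (simp del: mary.simps)
  finally show ?case by simp
qed

lemma migrate_raise_one:
  assumes "m \<ge> 2" and "q \<ge> 2"
  shows "(migrate m ^^ s) ((raise m q ^^ t) (mary m [1])) =
    (if s > 0 then mary m (1 # replicate (s - 1) 0 @ [q ^ t - 1]) else mary m [q ^ t])"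
proof -
  have "(raise m q ^^ t) (mary m [1]) = mary m [q ^ t]"
    using raise_funpow_mary[OF assms, of 1 t "[]"] by (simp del: mary.simps)
  moreover have "q ^ t \<noteq> 0" using assms by simp
  ultimately show ?thesis using migrate_funpow_mary[OF assms(1), of "q ^ t" "s - 1" "[]"]
    by (cases s) (simp_all del: mary.simps funpow.simps(2))
qed

lemma migrate_raise_one_eq_add_mset:
  assumes "m \<ge> 2" and "q \<ge> 2"
  shows "(migrate m ^^ s) ((raise m q ^^ t) (mary m [1])) =
    add_mset (m ^ s) (replicate_mset (q ^ t - 1) 1)"
proof (cases s)
  case 0
  have "replicate_mset (q ^ t) 1 = add_mset 1 (replicate_mset (q ^ t - 1) (1 :: nat))"
    using assms(2) by (cases "q ^ t") simp_all
  then show ?thesis unfolding migrate_raise_one[OF assms] using 0 by simp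
next
  case (Suc k)
  then show ?thesis unfolding migrate_raise_one[OF assms] by (simp add: mary_append_zeros)
qed

lemma raise_migrate_one:
  assumes "m \<ge> 2" and "q \<ge> 2"
  shows "(raise m q ^^ t) ((migrate m ^^ s) (mary m [1])) = mary m (q ^ t # replicate s 0)"
proof -
  have "(migrate m ^^ s) (mary m [1]) = mary m (1 # replicate s 0)"
  proof (cases s)
    case (Suc k)
    then show ?thesis using migrate_funpow_mary[OF assms(1), of 1 k "[]"]
      by (simp add: replicate_append_same del: mary.simps funpow.simps(2))
  qed simp
  then show ?thesis using raise_funpow_mary[OF assms, of 1 t "replicate s 0"]
    by (simp del: mary.simps)
qed

lemma raise_migrate_one_eq_replicate_mset:
  assumes "m \<ge> 2" and "q \<ge> 2"
  shows "(raise m q ^^ t) ((migrate m ^^ s) (mary m [1])) = replicate_mset (q ^ t) (m ^ s)"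
  unfolding raise_migrate_one[OF assms] by (simp add: mary_zeros)

lemma apply_ops_in_generated:
  assumes "m \<ge> 2" and "q \<ge> 2" and "count_list A R = t" and "count_list A M = s"
  shows "apply_ops m q A (mary m [1]) \<in> generated m q s t"
  using conj_ary_apply_ops[OF assms(1,2)] assms(3,4) unfolding generated_def by blast

lemma count_list_replicate_op: "count_list (replicate n x) y = (if x = y then n else 0)"
  by (induction n) auto

lemma migrate_raise_one_generated:
  assumes "m \<ge> 2" and "q \<ge> 2"
  shows "(migrate m ^^ s) ((raise m q ^^ t) (mary m [1])) \<in> generated m q s t"
  using apply_ops_in_generated[OF assms, of "replicate s M @ replicate t R"]
  by (simp add: apply_ops_def count_list_replicate_op foldr_replicate del: mary.simps)

lemma raise_migrate_one_generated:
  assumes "m \<ge> 2" and "q \<ge> 2"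
  shows "(raise m q ^^ t) ((migrate m ^^ s) (mary m [1])) \<in> generated m q s t"
  using apply_ops_in_generated[OF assms, of "replicate t R @ replicate s M"]
  by (simp add: apply_ops_def count_list_replicate_op foldr_replicate del: mary.simps)

section \<open>Extremal numbers and their partitions\<close>

theorem corollary3p14:
  fixes m q s t :: nat
  assumes "m \<ge> 2" and "q \<ge> 2"
  shows
    "(Min {n. \<exists>\<nu> \<in> generated m q s t. partitions \<nu> n} = m ^ s + q ^ t - 1 \<and>
      {\<nu> \<in> generated m q s t. partitions \<nu> (m ^ s + q ^ t - 1)}
        = {(migrate m ^^ s) ((raise m q ^^ t) (mary m [1]))} \<and>
      (migrate m ^^ s) ((raise m q ^^ t) (mary m [1]))
        = (if s > 0 then mary m (1 # replicate (s - 1) 0 @ [q ^ t - 1]) else mary m [q ^ t])) \<and>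
     (Max {n. \<exists>\<nu> \<in> generated m q s t. partitions \<nu> n} = m ^ s * q ^ t \<and>
      {\<nu> \<in> generated m q s t. partitions \<nu> (m ^ s * q ^ t)}
        = {(raise m q ^^ t) ((migrate m ^^ s) (mary m [1]))} \<and>
      (raise m q ^^ t) ((migrate m ^^ s) (mary m [1])) = mary m (q ^ t # replicate s 0))"
proof -
  let ?N = "{n. \<exists>\<nu> \<in> generated m q s t. partitions \<nu> n}"
  let ?lo = "(migrate m ^^ s) ((raise m q ^^ t) (mary m [1]))"
  let ?hi = "(raise m q ^^ t) ((migrate m ^^ s) (mary m [1]))"
  have lo: "?lo \<in> generated m q s t" "?lo = add_mset (m ^ s) (replicate_mset (q ^ t - 1) 1)"
    using migrate_raise_one_generated[OF assms] migrate_raise_one_eq_add_mset[OF assms] .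
  have hi: "?hi \<in> generated m q s t" "?hi = replicate_mset (q ^ t) (m ^ s)"
    using raise_migrate_one_generated[OF assms] raise_migrate_one_eq_replicate_mset[OF assms] .
  have "1 \<le> q ^ t" using assms(2) by simp
  then have sum_lo: "sum_mset ?lo = m ^ s + q ^ t - 1" unfolding lo(2) by simp
  have sum_hi: "sum_mset ?hi = m ^ s * q ^ t" unfolding hi(2) by simp
  have part_lo: "partitions ?lo (m ^ s + q ^ t - 1)"
    using partitions_generated_iff[OF lo(1)] sum_lo by blast
  have part_hi: "partitions ?hi (m ^ s * q ^ t)"
    using partitions_generated_iff[OF hi(1)] sum_hi by blast
  have "Min ?N = m ^ s + q ^ t - 1"
  proof (rule Min_eqI[OF finite_partitioned])
    show "m ^ s + q ^ t - 1 \<le> n" if "n \<in> ?N" for n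
      using that sum_generated_ge[OF assms] by (auto simp: partitions_generated_iff)
    show "m ^ s + q ^ t - 1 \<in> ?N" using lo(1) part_lo by blast
  qed
  moreover have "Max ?N = m ^ s * q ^ t"
  proof (rule Max_eqI[OF finite_partitioned])
    show "n \<le> m ^ s * q ^ t" if "n \<in> ?N" for n
      using that sum_generated_le[OF assms] by (auto simp: partitions_generated_iff)
    show "m ^ s * q ^ t \<in> ?N" using hi(1) part_hi by blast
  qed
  moreover have "\<nu> = ?lo" if "\<nu> \<in> generated m q s t" "partitions \<nu> (m ^ s + q ^ t - 1)" for \<nu>
    using sum_generated_eq_lower[OF assms that(1)] that partitions_generated_iff lo(2) by metis
  then have "{\<nu> \<in> generated m q s t. partitions \<nu> (m ^ s + q ^ t - 1)} = {?lo}"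
    using lo(1) part_lo by blast
  moreover have "\<nu> = ?hi" if "\<nu> \<in> generated m q s t" "partitions \<nu> (m ^ s * q ^ t)" for \<nu>
    using sum_generated_eq_upper[OF assms that(1)] that partitions_generated_iff hi(2) by metis
  then have "{\<nu> \<in> generated m q s t. partitions \<nu> (m ^ s * q ^ t)} = {?hi}"
    using hi(1) part_hi by blast
  ultimately show ?thesis
    using migrate_raise_one[OF assms] raise_migrate_one[OF assms] by blast
qed

end
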